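(* Let $(X,d)$ be a compact metric space, $f: X \to X$ a continuous map and $\varphi: X \to \mathbb{R}$ a continuous function. Define $L_\varphi: X\to\mathbb{R}$ by $$L_\varphi(x)=\limsup_{n\to+\infty} \frac1n \sum_{j=0}^{n-1} \varphi(f^j(x)).$$ Assume that there exist two dense subsets $\mathcal{A}$ and $\mathcal{B}$ of $X$ such that the restriction of $L_\varphi$ to $\mathcal{A}$ is constant, the restriction of $L_\varphi$ to $\mathcal{B}$ is constant, and the value at $\mathcal{A}$ is different from the value at $\mathcal{B}$. Then the set $$\mathfrak I_\varphi = \Big\{x \in X : \Big(\frac1n\sum_{j=0}^{n-1} \varphi(f^j(x))\Big)_{n \in \mathbb{N}} \text{ does not converge}\Big\}$$ is a Baire residual subset of $X$.
   Context: A subset of a topological space is Baire residual if it contains a countable intersection of open dense subsets (equivalently, its complement is contained in a countable union of closed sets with empty interior). *)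

theory Defs
  imports "HOL-Analysis.Analysis"
begin

definition baire_residual :: "'a topology \<Rightarrow> 'a set \<Rightarrow> bool" where
  "baire_residual T S \<longleftrightarrow>
     S \<subseteq> topspace T \<and>
     (\<exists>U :: nat \<Rightarrow> 'a set. (\<forall>n. openin T (U n) \<and> T closure_of (U n) = topspace T) \<and> (\<Inter>n. U n) \<subseteq> S)"

definition birkhoff_average :: "('a \<Rightarrow> 'a) \<Rightarrow> ('a \<Rightarrow> real) \<Rightarrow> nat \<Rightarrow> 'a \<Rightarrow> real" where
  "birkhoff_average f \<phi> n x = (1 / real n) * (\<Sum>j<n. \<phi> ((f ^^ j) x))"

text \<open>
  The upper limit is taken in the extended reals and then read as a real number. Nothing is lost
  when the values of \<open>\<phi>\<close> along the orbit are bounded, as they are for a continuous function on a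
  compact space: see \<open>ereal_upper_birkhoff_limit\<close> below.
\<close>
definition upper_birkhoff_limit :: "('a \<Rightarrow> 'a) \<Rightarrow> ('a \<Rightarrow> real) \<Rightarrow> 'a \<Rightarrow> real" where
  "upper_birkhoff_limit f \<phi> x = real_of_ereal (limsup (\<lambda>n. ereal (birkhoff_average f \<phi> n x)))"

definition irregular_set :: "'a set \<Rightarrow> ('a \<Rightarrow> 'a) \<Rightarrow> ('a \<Rightarrow> real) \<Rightarrow> 'a set" where
  "irregular_set X f \<phi> = {x \<in> X. \<not> convergent (\<lambda>n. birkhoff_average f \<phi> n x)}"

lemma abs_birkhoff_average_le:
  assumes "\<And>j. \<bar>\<phi> ((f ^^ j) x)\<bar> \<le> C"
  shows "\<bar>birkhoff_average f \<phi> n x\<bar> \<le> C"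
proof (cases "n = 0")
  case True
  then show ?thesis
    using assms[of 0] by (simp add: birkhoff_average_def)
next
  case False
  have "\<bar>\<Sum>j<n. \<phi> ((f ^^ j) x)\<bar> \<le> (\<Sum>j<n. \<bar>\<phi> ((f ^^ j) x)\<bar>)"
    by (rule sum_abs)
  also have "\<dots> \<le> real n * C"
    using sum_bounded_above[of "{..<n}" "\<lambda>j. \<bar>\<phi> ((f ^^ j) x)\<bar>" C] assms by simp
  finally show ?thesis
    using False by (simp add: birkhoff_average_def abs_mult field_simps)
qed

lemma ereal_upper_birkhoff_limit:
  assumes "\<And>j. \<bar>\<phi> ((f ^^ j) x)\<bar> \<le> C"
  shows "ereal (upper_birkhoff_limit f \<phi> x) = limsup (\<lambda>n. ereal (birkhoff_average f \<phi> n x))"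
proof -
  let ?u = "\<lambda>n. ereal (birkhoff_average f \<phi> n x)"
  have b: "- C \<le> birkhoff_average f \<phi> n x" "birkhoff_average f \<phi> n x \<le> C" for n
    using abs_birkhoff_average_le[of \<phi> f x C n, OF assms] by linarith+
  have "limsup ?u \<le> ereal C"
    by (rule Limsup_bounded) (simp add: b)
  moreover have "ereal (- C) \<le> limsup ?u"
    by (rule order_trans[OF _ Liminf_le_Limsup], rule Liminf_bounded) (simp_all add: b del: uminus_ereal.simps)
  ultimately have "\<bar>limsup ?u\<bar> \<noteq> \<infinity>"
    by auto
  then show ?thesis
    by (simp add: upper_birkhoff_limit_def ereal_real)
qed

end

theory Submission
  imports Defs
begin

text \<open>
  By symmetry let \<open>a < b\<close>, and choose \<open>a < p < q < b\<close>. For every \<open>N\<close>, the points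
  whose Birkhoff average drops below \<open>p\<close> at some time \<open>n \<ge> N\<close> form an open set, because each average
  is continuous. This set contains the dense set \<open>A\<close>: an upper limit below \<open>p\<close> keeps the averages
  below \<open>p\<close> from some time on. Likewise the points whose average exceeds \<open>q\<close> at some time \<open>n \<ge> N\<close>
  form an open set that contains the dense set \<open>B\<close>, since an upper limit above \<open>q\<close> makes the
  averages exceed \<open>q\<close> infinitely often. A point lying in all these open dense sets has averages
  that oscillate across the gap between \<open>p\<close> and \<open>q\<close> forever, so they diverge.

  Lemma \<open>baire_residual_oscillation\<close> is this category argument for an arbitrary sequence
  of continuous functions. Compactness serves only to bound the averages, so that the real-valued
  upper limit is the true one (\<open>limsup_birkhoff_average_eq\<close>).
\<close>

lemma closure_of_Int_open_dense:
  assumes "openin T V" "T closure_of V = topspace T" "T closure_of W = topspace T"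
  shows "T closure_of (V \<inter> W) = topspace T"
proof -
  have "T closure_of (V \<inter> W) = T closure_of (V \<inter> T closure_of W)"
    using assms(1) by (simp add: closure_of_openin_Int_closure_of)
  also have "V \<inter> T closure_of W = V"
    using assms by (auto dest: openin_subset)
  finally show ?thesis
    using assms by simp
qed

lemma dense_superset:
  assumes "T closure_of A = topspace T" "A \<subseteq> V"
  shows "T closure_of V = topspace T"
  using assms closure_of_mono[of A V T] closure_of_subset_topspace[of T V] by auto

lemma not_convergent_oscillation:
  fixes u :: "nat \<Rightarrow> real"
  assumes "\<exists>\<^sub>F n in sequentially. u n < p" "\<exists>\<^sub>F n in sequentially. u n > q" "p < q"
  shows "\<not> convergent u"
proof
  assume "convergent u"
  then obtain l where l: "u \<longlonglongrightarrow> l"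
    by (auto simp: convergent_def)
  \<comment> \<open>Eventually the sequence would stay above \<open>p\<close> or stay below \<open>q\<close>.\<close>
  consider "p < l" | "l < q"
    using assms(3) by linarith
  then show False
  proof cases
    case 1
    have "\<forall>\<^sub>F n in sequentially. \<not> u n < p"
      using order_tendstoD(1)[OF l 1] by (rule eventually_mono) simp
    then show False
      using assms(1) by (simp add: frequently_def)
  next
    case 2
    have "\<forall>\<^sub>F n in sequentially. \<not> u n > q"
      using order_tendstoD(2)[OF l 2] by (rule eventually_mono) simp
    then show False
      using assms(2) by (simp add: frequently_def)
  qed
qed

text \<open>
  Being frequently below \<open>p\<close> is a countable intersection of the open conditions that some index
  beyond \<open>N\<close> has value below \<open>p\<close>, and each of these holds on the dense set \<open>A\<close>; symmetrically above
  \<open>q\<close> on \<open>B\<close>. Even when \<open>A\<close> and \<open>B\<close> are disjoint, openness lets both conditions hold together on a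
  dense set.
\<close>
lemma baire_residual_oscillation:
  fixes g :: "nat \<Rightarrow> 'a \<Rightarrow> real"
  assumes cont: "\<And>n. continuous_map T euclideanreal (g n)"
    and A: "A \<subseteq> topspace T" "T closure_of A = topspace T"
    and B: "B \<subseteq> topspace T" "T closure_of B = topspace T"
    and below: "\<And>x. x \<in> A \<Longrightarrow> \<exists>\<^sub>F n in sequentially. g n x < p"
    and above: "\<And>x. x \<in> B \<Longrightarrow> \<exists>\<^sub>F n in sequentially. g n x > q"
    and "p < q"
  shows "baire_residual T {x \<in> topspace T. \<not> convergent (\<lambda>n. g n x)}"
proof -
  define V where "V N = (\<Union>n\<in>{N..}. {x \<in> topspace T. g n x \<in> {..<p}})" for N :: nat
  define W where "W N = (\<Union>n\<in>{N..}. {x \<in> topspace T. g n x \<in> {q<..}})" for N :: nat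
  have preimage_open: "openin T {x \<in> topspace T. g n x \<in> U}" if "open U" for n U
    using openin_continuous_map_preimage[OF cont] that by simp
  have V_open: "openin T (V N)" for N
    unfolding V_def by (rule openin_Union, erule imageE, hypsubst, rule preimage_open, simp)
  have W_open: "openin T (W N)" for N
    unfolding W_def by (rule openin_Union, erule imageE, hypsubst, rule preimage_open, simp)
  have "A \<subseteq> V N" for N
    using A(1) below by (fastforce simp: V_def frequently_sequentially)
  then have V_dense: "T closure_of V N = topspace T" for N
    by (rule dense_superset[OF A(2)])
  have "B \<subseteq> W N" for N
    using B(1) above by (fastforce simp: W_def frequently_sequentially)
  then have W_dense: "T closure_of W N = topspace T" for N
    by (rule dense_superset[OF B(2)])
  have "(\<Inter>N. V N \<inter> W N) \<subseteq> {x \<in> topspace T. \<not> convergent (\<lambda>n. g n x)}"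
  proof
    fix x
    assume "x \<in> (\<Inter>N. V N \<inter> W N)"
    then have x: "x \<in> V N" "x \<in> W N" for N
      by auto
    have "x \<in> topspace T"
      using x(1)[of 0] by (auto simp: V_def)
    moreover have "\<exists>\<^sub>F n in sequentially. g n x < p" "\<exists>\<^sub>F n in sequentially. g n x > q"
      using x by (auto simp: V_def W_def frequently_sequentially Bex_def)
    ultimately show "x \<in> {x \<in> topspace T. \<not> convergent (\<lambda>n. g n x)}"
      using not_convergent_oscillation \<open>p < q\<close> by simp
  qed
  moreover have "openin T (V N \<inter> W N)" "T closure_of (V N \<inter> W N) = topspace T" for N
    using V_open W_open V_dense W_dense by (simp_all add: openin_Int closure_of_Int_open_dense)
  ultimately show ?thesis
    unfolding baire_residual_def by (intro conjI exI[of _ "\<lambda>N. V N \<inter> W N"]) simp_all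
qed

lemma continuous_map_funpow:
  assumes "continuous_map T T f"
  shows "continuous_map T T (f ^^ n)"
proof (induction n)
  case 0
  then show ?case by (simp add: id_def)
next
  case (Suc n)
  then show ?case
    using continuous_map_compose[OF Suc assms] by (simp add: o_def)
qed

lemma continuous_map_birkhoff_average:
  assumes "continuous_map T T f" "continuous_map T euclideanreal \<phi>"
  shows "continuous_map T euclideanreal (birkhoff_average f \<phi> n)"
proof -
  have "continuous_map T euclideanreal (\<lambda>x. \<phi> ((f ^^ j) x))" for j
    using continuous_map_compose[OF continuous_map_funpow[OF assms(1)] assms(2)]
    by (simp add: o_def)
  then show ?thesis
    unfolding birkhoff_average_def
    by (intro continuous_map_real_mult continuous_map_sum) auto
qed

text \<open>
  The image of a compact space under \<open>\<phi>\<close> is bounded, and orbits stay inside the space, so reading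
  the upper limit as a real number loses nothing.
\<close>
lemma limsup_birkhoff_average_eq:
  assumes "compact_space T" "continuous_map T T f" "continuous_map T euclideanreal \<phi>"
    and "x \<in> topspace T"
  shows "limsup (\<lambda>n. ereal (birkhoff_average f \<phi> n x)) = ereal (upper_birkhoff_limit f \<phi> x)"
proof -
  have "compact (\<phi> ` topspace T)"
    using image_compactin[OF _ assms(3)] assms(1) by (simp add: compact_space_def)
  then have "\<exists>C. \<forall>y\<in>topspace T. \<bar>\<phi> y\<bar> \<le> C"
    by (auto dest!: compact_imp_bounded simp: bounded_iff)
  then obtain C where C: "\<And>y. y \<in> topspace T \<Longrightarrow> \<bar>\<phi> y\<bar> \<le> C"
    by blast
  have "(f ^^ j) x \<in> topspace T" for j
    using continuous_map_image_subset_topspace[OF continuous_map_funpow[OF assms(2)]] assms(4)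
    by blast
  then show ?thesis
    using ereal_upper_birkhoff_limit[of \<phi> f x C] C by simp
qed

lemma frequently_less_if_limsup_less:
  assumes "limsup (\<lambda>n. ereal (u n)) = ereal l" "l < p"
  shows "\<exists>\<^sub>F n in sequentially. u n < p"
proof -
  have "\<forall>\<^sub>F n in sequentially. ereal (u n) < ereal p"
    by (rule Limsup_lessD) (simp add: assms)
  then show ?thesis
    by (intro eventually_frequently) simp_all
qed

lemma frequently_greater_if_limsup_greater:
  assumes "limsup (\<lambda>n. ereal (u n)) = ereal l" "q < l"
  shows "\<exists>\<^sub>F n in sequentially. u n > q"
proof (rule ccontr)
  assume "\<not> ?thesis"
  then have "limsup (\<lambda>n. ereal (u n)) \<le> ereal q"
    by (intro Limsup_bounded) (simp add: frequently_def not_less)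
  then show False
    using assms by simp
qed

lemma baire_residual_irregular_set:
  assumes "compact_space T" "continuous_map T T f" "continuous_map T euclideanreal \<phi>"
    and A: "A \<subseteq> topspace T" "T closure_of A = topspace T"
    and B: "B \<subseteq> topspace T" "T closure_of B = topspace T"
    and a: "\<And>x. x \<in> A \<Longrightarrow> upper_birkhoff_limit f \<phi> x = a"
    and b: "\<And>x. x \<in> B \<Longrightarrow> upper_birkhoff_limit f \<phi> x = b"
    and "a < b"
  shows "baire_residual T (irregular_set (topspace T) f \<phi>)"
proof -
  obtain p where "a < p" "p < b"
    using \<open>a < b\<close> dense by blast
  obtain q where "p < q" "q < b"
    using \<open>p < b\<close> dense by blast
  note limsup_eq = limsup_birkhoff_average_eq[OF assms(1-3)]
  show ?thesis
    unfolding irregular_set_def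
  proof (rule baire_residual_oscillation[OF _ A B _ _ \<open>p < q\<close>])
    show "\<exists>\<^sub>F n in sequentially. birkhoff_average f \<phi> n x < p" if "x \<in> A" for x
      using that A(1) \<open>a < p\<close> limsup_eq[of x] a[of x]
      by (intro frequently_less_if_limsup_less[of _ a]) auto
    show "\<exists>\<^sub>F n in sequentially. birkhoff_average f \<phi> n x > q" if "x \<in> B" for x
      using that B(1) \<open>q < b\<close> limsup_eq[of x] b[of x]
      by (intro frequently_greater_if_limsup_greater[of _ b]) auto
  qed (use assms continuous_map_birkhoff_average in blast)
qed

theorem theorem1:
  fixes X :: "'a set" and d :: "'a \<Rightarrow> 'a \<Rightarrow> real"
    and f :: "'a \<Rightarrow> 'a" and \<phi> :: "'a \<Rightarrow> real"
    and A B :: "'a set" and a b :: real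
  assumes "Metric_space X d"
    and "compact_space (Metric_space.mtopology X d)"
    and "continuous_map (Metric_space.mtopology X d) (Metric_space.mtopology X d) f"
    and "continuous_map (Metric_space.mtopology X d) euclideanreal \<phi>"
    and "A \<subseteq> X" and "Metric_space.mtopology X d closure_of A = X"
    and "B \<subseteq> X" and "Metric_space.mtopology X d closure_of B = X"
    and "\<forall>x\<in>A. upper_birkhoff_limit f \<phi> x = a"
    and "\<forall>x\<in>B. upper_birkhoff_limit f \<phi> x = b"
    and "a \<noteq> b"
  shows "baire_residual (Metric_space.mtopology X d) (irregular_set X f \<phi>)"
proof -
  have X: "topspace (Metric_space.mtopology X d) = X"
    using assms(1) by (rule Metric_space.topspace_mtopology)
  consider "a < b" | "b < a"
    using assms(11) by linarith
  then show ?thesis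
  proof cases
    case 1
    then show ?thesis
      using baire_residual_irregular_set[OF assms(2-4), of A B a b] assms(5-10) X by simp
  next
    case 2
    then show ?thesis
      using baire_residual_irregular_set[OF assms(2-4), of B A b a] assms(5-10) X by simp
  qed
qed

end
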